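(* Let $\rho>0$ be a smooth scalar field and $\mathbf u$ a smooth vector field on $\Omega$, let $\langle\rho_h\rangle$ and $\widetilde{\mathbf u}_h$ be the filtered density and filtered velocity on $U_h$, and let the sub-particle stress (sub-grid stress) tensor be $$\langle\underline{\underline{\mathcal H}}_h(\mathbf r)\rangle=\int_{\Omega_h(\mathbf r)}\rho(\mathbf r')\big(\mathbf u(\mathbf r')-\widetilde{\mathbf u}_h(\mathbf r)\big)\otimes\big(\mathbf u(\mathbf r')-\widetilde{\mathbf u}_h(\mathbf r)\big)\,w_h(\mathbf r-\mathbf r')\,d^n\mathbf r',\qquad \mathbf r\in U_h.$$ Then for all $\mathbf r\in U_h$, $$\nabla\cdot\langle\underline{\underline{\mathcal H}}_h(\mathbf r)\rangle=\int_{\Omega_h(\mathbf r)}\rho(\mathbf r')\Big[\big(\mathbf u(\mathbf r')-\widetilde{\mathbf u}_h(\mathbf r)\big)\otimes\big(\mathbf u(\mathbf r')-\widetilde{\mathbf u}_h(\mathbf r)\big)\Big]\cdot\nabla w_h(\mathbf r-\mathbf r')\,d^n\mathbf r'.$$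
   Context: Let $\Omega\subseteq\mathbb R^n$ be an open set (the fluid domain), $h>0$ a fixed filter length and $\kappa>0$ a fixed constant. The filter (kernel) $w_h\in C_c^\infty(\mathbb R^n)$ is real-valued, satisfies $w_h\ge 0$ and $\int_{\mathbb R^n}w_h=1$, and is supported in the closed ball of radius $\kappa h$ about $0$. For a point $\mathbf r$, the test space is $\Omega_h(\mathbf r)=\{\mathbf r':\|\mathbf r-\mathbf r'\|\le\kappa h\}$; set $U_h=\{\mathbf r\in\Omega:\Omega_h(\mathbf r)\subset\Omega\}$, the open set of points whose test space lies within the fluid domain. For $\mathbf r\in U_h$ the filtered density and filtered (density-weighted) velocity are defined by $$\langle\rho_h(\mathbf r)\rangle=\int_{\Omega_h(\mathbf r)}\rho(\mathbf r')w_h(\mathbf r-\mathbf r')\,d^n\mathbf r',\qquad \langle\rho_h(\mathbf r)\rangle\,\widetilde{\mathbf u}_h(\mathbf r)=\int_{\Omega_h(\mathbf r)}\rho(\mathbf r')\mathbf u(\mathbf r')w_h(\mathbf r-\mathbf r')\,d^n\mathbf r'.$$ In the integral $\nabla w_h(\mathbf r-\mathbf r')$ denotes the gradient with respect to $\mathbf r$ of $w_h(\mathbf r-\mathbf r')$; $(\mathbf a\otimes\mathbf c)\cdot\mathbf d=\mathbf a\,(\mathbf c\cdot\mathbf d)$; and the divergence of a (symmetric) tensor field is $(\nabla\cdot\underline{\underline{T}})_i=\sum_j\partial_jT_{ij}$. *)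

theory Defs
  imports "HOL-Analysis.Analysis"
begin

text \<open>Iterated differentiability on a set; intended for open sets, since derivatives are
  taken with respect to full neighbourhoods.\<close>

fun Ck_on :: "nat \<Rightarrow> 'a::real_normed_vector set \<Rightarrow> ('a \<Rightarrow> 'b::real_normed_vector) \<Rightarrow> bool" where
  "Ck_on 0 S f \<longleftrightarrow> continuous_on S f"
| "Ck_on (Suc k) S f \<longleftrightarrow>
     (\<forall>x\<in>S. f differentiable (at x)) \<and>
     (\<forall>v. Ck_on k S (\<lambda>x. frechet_derivative f (at x) v))"

definition smooth_on :: "'a::real_normed_vector set \<Rightarrow> ('a \<Rightarrow> 'b::real_normed_vector) \<Rightarrow> bool" where
  "smooth_on S f \<longleftrightarrow> (\<forall>k. Ck_on k S f)"

definition partial_deriv :: "'n::finite \<Rightarrow> (real^'n \<Rightarrow> real) \<Rightarrow> real^'n \<Rightarrow> real" where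
  "partial_deriv j f x = deriv (\<lambda>t. f (x + t *\<^sub>R axis j 1)) 0"

definition grad :: "(real^'n::finite \<Rightarrow> real) \<Rightarrow> real^'n \<Rightarrow> real^'n" where
  "grad f x = (\<chi> j. partial_deriv j f x)"

text \<open>\<open>T x $ i $ j\<close> is the component \<open>T\<^sub>i\<^sub>j\<close>, so the divergence contracts the second index.\<close>

definition tensor_div :: "(real^'n::finite \<Rightarrow> real^'n^'n) \<Rightarrow> real^'n \<Rightarrow> real^'n" where
  "tensor_div T x = (\<chi> i. \<Sum>j\<in>UNIV. partial_deriv j (\<lambda>y. T y $ i $ j) x)"

text \<open>The contraction of a tensor with a vector is the matrix-vector product \<open>*v\<close>.\<close>

definition tensor_prod :: "real^'n::finite \<Rightarrow> real^'n \<Rightarrow> real^'n^'n" where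
  "tensor_prod a c = (\<chi> i j. a $ i * c $ j)"

lemma tensor_prod_contract: "tensor_prod a c *v d = (c \<bullet> d) *\<^sub>R a"
  by (simp add: tensor_prod_def matrix_vector_mult_def vec_eq_iff inner_vec_def
      sum_distrib_left mult_ac)

definition filter_kernel :: "real \<Rightarrow> real \<Rightarrow> (real^'n::finite \<Rightarrow> real) \<Rightarrow> bool" where
  "filter_kernel \<kappa> h w \<longleftrightarrow>
     smooth_on UNIV w \<and> compact (closure {x. w x \<noteq> 0}) \<and>
     (\<forall>x. w x \<ge> 0) \<and> (LINT x|lborel. w x) = 1 \<and>
     closure {x. w x \<noteq> 0} \<subseteq> cball 0 (\<kappa> * h)"

definition test_space :: "real \<Rightarrow> real \<Rightarrow> real^'n::finite \<Rightarrow> (real^'n) set" where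
  "test_space \<kappa> h r = {r'. norm (r - r') \<le> \<kappa> * h}"

definition filter_domain :: "real \<Rightarrow> real \<Rightarrow> (real^'n::finite) set \<Rightarrow> (real^'n) set" where
  "filter_domain \<kappa> h \<Omega> = {r \<in> \<Omega>. test_space \<kappa> h r \<subseteq> \<Omega>}"

definition filtered_density ::
  "real \<Rightarrow> real \<Rightarrow> (real^'n::finite \<Rightarrow> real) \<Rightarrow> (real^'n \<Rightarrow> real) \<Rightarrow> real^'n \<Rightarrow> real" where
  "filtered_density \<kappa> h w \<rho> r =
     (LINT r':test_space \<kappa> h r|lborel. \<rho> r' * w (r - r'))"

text \<open>The division is legitimate: the filtered density is positive at points of
  \<open>filter_domain \<kappa> h \<Omega>\<close> whenever \<open>\<rho>\<close> is continuous and positive on \<open>\<Omega>\<close>.\<close>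

definition filtered_velocity ::
  "real \<Rightarrow> real \<Rightarrow> (real^'n::finite \<Rightarrow> real) \<Rightarrow> (real^'n \<Rightarrow> real) \<Rightarrow> (real^'n \<Rightarrow> real^'n) \<Rightarrow>
   real^'n \<Rightarrow> real^'n" where
  "filtered_velocity \<kappa> h w \<rho> u r =
     (LINT r':test_space \<kappa> h r|lborel. (\<rho> r' * w (r - r')) *\<^sub>R u r') /\<^sub>R
       filtered_density \<kappa> h w \<rho> r"

definition subgrid_stress ::
  "real \<Rightarrow> real \<Rightarrow> (real^'n::finite \<Rightarrow> real) \<Rightarrow> (real^'n \<Rightarrow> real) \<Rightarrow> (real^'n \<Rightarrow> real^'n) \<Rightarrow>
   real^'n \<Rightarrow> real^'n^'n" where
  "subgrid_stress \<kappa> h w \<rho> u r =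
     (LINT r':test_space \<kappa> h r|lborel.
        (\<rho> r' * w (r - r')) *\<^sub>R
          tensor_prod (u r' - filtered_velocity \<kappa> h w \<rho> u r)
                      (u r' - filtered_velocity \<kappa> h w \<rho> u r))"

end

theory Submission
  imports Defs
begin

text \<open>
  Since the kernel vanishes outside the test space, near a fixed point every filtered integral
  runs over one fixed box, so filtering is differentiable under the integral sign with the
  derivative falling on the kernel.  Write \<open>m\<close>, \<open>p\<^sub>i\<close>, \<open>A\<^sub>i\<^sub>j\<close> for the filtered
  \<open>\<rho>\<close>, \<open>\<rho> u\<^sub>i\<close>, \<open>\<rho> u\<^sub>i u\<^sub>j\<close>.  The stress is then \<open>A\<^sub>i\<^sub>j - p\<^sub>i p\<^sub>j / m\<close>, and its
  derivative in any direction is the quadratic form in \<open>u - p/m\<close> integrated against the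
  derivative of the kernel.
\<close>

section \<open>Smoothness and partial derivatives\<close>

lemma smooth_on_continuous_on: "smooth_on S f \<Longrightarrow> continuous_on S f"
  unfolding smooth_on_def by (metis Ck_on.simps(1))

lemma smooth_on_has_derivative:
  assumes "smooth_on S f" "x \<in> S"
  shows "(f has_derivative frechet_derivative f (at x)) (at x)"
proof -
  have "Ck_on (Suc 0) S f" using assms(1) unfolding smooth_on_def by blast
  then show ?thesis using assms(2) by (simp add: frechet_derivative_works)
qed

lemma smooth_on_continuous_on_frechet_derivative:
  assumes "smooth_on S f"
  shows "continuous_on S (\<lambda>x. frechet_derivative f (at x) v)"
proof -
  have "Ck_on (Suc 0) S f" using assms unfolding smooth_on_def by blast
  then show ?thesis by simp
qed

text \<open>Chain rule along the line through \<open>r\<close> in direction \<open>axis j 1\<close>.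
  This links the one-variable \<open>deriv\<close> behind gradient and divergence to Frechet
  derivatives.\<close>

lemma partial_deriv_eq_derivative:
  assumes f: "(f has_derivative F) (at r)"
  shows "partial_deriv j f r = F (axis j 1)"
proof -
  have "((\<lambda>t::real. r + t *\<^sub>R axis j 1) has_derivative (\<lambda>t. t *\<^sub>R axis j 1)) (at 0)"
    by (auto intro!: derivative_eq_intros)
  moreover have "(f has_derivative F) (at (r + 0 *\<^sub>R axis j 1))" using f by simp
  ultimately have "((\<lambda>t. f (r + t *\<^sub>R axis j 1)) has_derivative (\<lambda>t. F (t *\<^sub>R axis j 1))) (at 0)"
    by (rule has_derivative_compose)
  moreover have "F (t *\<^sub>R axis j 1) = F (axis j 1) * t" for t
    using has_derivative_linear[OF f] by (simp add: linear_cmul mult.commute)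
  ultimately show ?thesis
    unfolding partial_deriv_def
    by (intro DERIV_imp_deriv) (simp add: has_field_derivative_def)
qed

section \<open>Integration over compact sets and reflection\<close>

lemma set_integrable_compact_continuous:
  fixes f :: "'a::euclidean_space \<Rightarrow> 'b::{banach, second_countable_topology}"
  assumes "compact K" "continuous_on K f"
  shows "set_integrable lborel K f"
  unfolding set_integrable_def using borel_integrable_compact[OF assms] by simp

lemma lborel_integral_reflect:
  fixes f :: "'a::euclidean_space \<Rightarrow> real"
  assumes "f \<in> borel_measurable borel"
  shows "(LINT x|lborel. f (r - x)) = (LINT x|lborel. f x)"
proof -
  \<comment> \<open>Affine change of variables with factor -1, whose Jacobian has modulus 1.\<close>
  have "lborel = density (distr lborel borel (\<lambda>x. r + (-1) *\<^sub>R x)) (\<lambda>_. ennreal (\<bar>-1\<bar> ^ DIM('a)))"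
    by (rule lborel_affine) simp
  then have "lborel = distr lborel borel (\<lambda>x. r - x)"
    by (simp add: density_1)
  then have "(LINT x|lborel. f x) = (LINT x|distr lborel borel (\<lambda>x. r - x). f x)"
    by simp
  also have "\<dots> = (LINT x|lborel. f (r - x))"
    using assms by (intro integral_distr) auto
  finally show ?thesis by simp
qed

section \<open>Test spaces, the kernel and its derivative\<close>

lemma test_space_eq_cball: "test_space \<kappa> h r = cball r (\<kappa> * h)"
  by (auto simp: test_space_def dist_norm)

context
  fixes \<kappa> h :: real and w :: "real^'n::finite \<Rightarrow> real" and \<Omega> :: "(real^'n) set"
  assumes kernel: "filter_kernel \<kappa> h w" and pos: "\<kappa> * h > 0" and op: "open \<Omega>"
begin

abbreviation Dw :: "real^'n \<Rightarrow> real^'n \<Rightarrow> real" where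
  "Dw x \<equiv> frechet_derivative w (at x)"

lemma kernel_smooth: "smooth_on UNIV w"
  using kernel by (simp add: filter_kernel_def)

lemma kernel_zero_outside:
  assumes "x \<notin> cball 0 (\<kappa> * h)"
  shows "w x = 0"
  using assms kernel closure_subset[of "{x. w x \<noteq> 0}"] unfolding filter_kernel_def by auto

lemma kernel_has_derivative: "(w has_derivative Dw x) (at x)"
  by (rule smooth_on_has_derivative[OF kernel_smooth]) simp

lemma shifted_kernel_has_derivative: "((\<lambda>s. w (s - x)) has_derivative Dw (s - x)) (at s)"
proof -
  have "((\<lambda>s. w (s - x)) has_derivative (\<lambda>v. Dw (s - x) (v - 0))) (at s)"
    by (rule has_derivative_compose[OF _ kernel_has_derivative]) (intro derivative_intros)
  then show ?thesis by simp
qed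

text \<open>The complement of the closed ball is open, so near \<open>x\<close> the kernel coincides
  with the zero function.\<close>

lemma Dw_zero_outside:
  assumes "x \<notin> cball 0 (\<kappa> * h)"
  shows "Dw x = (\<lambda>v. 0)"
proof -
  have "(w has_derivative (\<lambda>v. 0)) (at x)"
    by (rule has_derivative_transform_within_open[of "\<lambda>_. 0" _ _ _ "- cball 0 (\<kappa> * h)"])
      (use assms kernel_zero_outside in auto)
  then show ?thesis
    using kernel_has_derivative has_derivative_unique by blast
qed

lemma kernel_continuous: "continuous_on UNIV w"
  by (rule smooth_on_continuous_on[OF kernel_smooth])

lemma Dw_continuous: "continuous_on UNIV (\<lambda>x. Dw x v)"
  by (rule smooth_on_continuous_on_frechet_derivative[OF kernel_smooth])

section \<open>Neighbourhoods in the filter domain\<close>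

lemma filter_domain_neighbourhood:
  assumes "r \<in> filter_domain \<kappa> h \<Omega>"
  obtains e K where "e > 0" "compact K" "K \<subseteq> \<Omega>"
    "\<And>s. s \<in> ball r e \<Longrightarrow> test_space \<kappa> h s \<subseteq> K"
proof -
  let ?C = "cball r (\<kappa> * h)"
  have C: "?C \<subseteq> \<Omega>" using assms by (simp add: filter_domain_def test_space_eq_cball)
  have ne: "?C \<noteq> {}" using pos by simp
  \<comment> \<open>A compact set inside an open one has positive distance to the complement. The
    closed \<open>e\<close>-neighbourhood of the ball serves as \<open>K\<close>.\<close>
  obtain e where e: "e > 0" "{x. infdist x ?C \<le> e} \<subseteq> \<Omega>"
    using compact_in_open_separated[OF ne compact_cball op C] by metis
  show thesis
  proof
    show "e > 0" by fact
    show "compact {x. infdist x ?C \<le> e}"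
      by (rule compact_infdist_le[OF ne compact_cball e(1)])
    show "{x. infdist x ?C \<le> e} \<subseteq> \<Omega>" by fact
    show "test_space \<kappa> h s \<subseteq> {x. infdist x ?C \<le> e}" if "s \<in> ball r e" for s
    proof
      fix x assume "x \<in> test_space \<kappa> h s"
      \<comment> \<open>Translation by \<open>r - s\<close>, a vector shorter than \<open>e\<close>,
        carries the test space of \<open>s\<close> onto that of \<open>r\<close>.\<close>
      then have "x - s + r \<in> ?C" "dist x (x - s + r) \<le> e"
        using that by (auto simp: test_space_def dist_norm norm_minus_commute algebra_simps)
      then show "x \<in> {x. infdist x ?C \<le> e}" using infdist_le2 by blast
    qed
  qed
qed

text \<open>Openness of the filter domain: a formula for the stress valid there then holds near
  \<open>r\<close> and may be differentiated at \<open>r\<close>.\<close>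

lemma eventually_filter_domain:
  assumes "r \<in> filter_domain \<kappa> h \<Omega>"
  shows "\<forall>\<^sub>F s in nhds r. s \<in> filter_domain \<kappa> h \<Omega>"
proof -
  obtain e K where e: "e > 0" "K \<subseteq> \<Omega>" "\<And>s. s \<in> ball r e \<Longrightarrow> test_space \<kappa> h s \<subseteq> K"
    using filter_domain_neighbourhood[OF assms] by metis
  have "s \<in> filter_domain \<kappa> h \<Omega>" if "s \<in> ball r e" for s
  proof -
    have "s \<in> test_space \<kappa> h s" using pos by (simp add: test_space_def)
    then show ?thesis using e that unfolding filter_domain_def by blast
  qed
  then show ?thesis using e(1) by (auto simp: eventually_nhds intro!: exI[of _ "ball r e"])
qed

section \<open>Differentiation of filtered integrals\<close>

lemma set_integrable_test_space:
  fixes f :: "real^'n \<Rightarrow> 'b::{banach, second_countable_topology}"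
  assumes "continuous_on \<Omega> f" "r \<in> filter_domain \<kappa> h \<Omega>"
  shows "set_integrable lborel (test_space \<kappa> h r) f"
proof (rule set_integrable_compact_continuous)
  show "continuous_on (test_space \<kappa> h r) f"
    using assms continuous_on_subset unfolding filter_domain_def by blast
qed (simp add: test_space_eq_cball)

theorem filtered_integral_has_derivative:
  fixes f :: "real^'n \<Rightarrow> real"
  assumes f: "continuous_on \<Omega> f" and r: "r \<in> filter_domain \<kappa> h \<Omega>"
  shows "((\<lambda>s. LINT x:test_space \<kappa> h s|lborel. f x * w (s - x)) has_derivative
      (\<lambda>v. LINT x:test_space \<kappa> h r|lborel. f x * Dw (r - x) v)) (at r)"
proof -
  obtain e K where e: "e > 0" and K: "compact K" "K \<subseteq> \<Omega>"
    and TK: "\<And>s. s \<in> ball r e \<Longrightarrow> test_space \<kappa> h s \<subseteq> K"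
    using filter_domain_neighbourhood[OF r] by metis
  \<comment> \<open>Leibniz' rule is available on boxes only, and no box around \<open>K\<close> need lie in \<open>\<Omega>\<close>.\<close>
  obtain g where g: "continuous_on UNIV g" and gf: "\<And>x. x \<in> K \<Longrightarrow> g x = f x"
    by (rule Tietze_unbounded[of K f UNIV])
      (use K f in \<open>auto intro: continuous_on_subset compact_imp_closed\<close>)
  obtain b where b: "K \<subseteq> cbox (-b) b"
    using bounded_subset_cbox_symmetric[OF compact_imp_bounded[OF K(1)]] by metis
  \<comment> \<open>Replaces the moving test space by a fixed box, so that no boundary term arises.
    Inside the test space \<open>g\<close> agrees with \<open>f\<close>; outside it
    \<open>F (s - x)\<close> vanishes. It is applied with \<open>F\<close> the kernel and with
    \<open>F\<close> a directional derivative of it.\<close>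
  have move: "(LINT x:test_space \<kappa> h s|lborel. f x * F (s - x)) =
      integral (cbox (-b) b) (\<lambda>x. g x * F (s - x))"
    if s: "s \<in> ball r e" and F: "continuous_on UNIV F" "\<And>x. x \<notin> cball 0 (\<kappa> * h) \<Longrightarrow> F x = 0"
    for s and F :: "real^'n \<Rightarrow> real"
  proof -
    have "indicator (test_space \<kappa> h s) x *\<^sub>R (f x * F (s - x)) =
        indicator (cbox (-b) b) x *\<^sub>R (g x * F (s - x))" for x
    proof (cases "x \<in> test_space \<kappa> h s")
      case True
      then show ?thesis using TK[OF s] b gf by (auto simp: indicator_def)
    next
      case False
      then have "F (s - x) = 0" by (intro F(2)) (simp add: test_space_def)
      then show ?thesis by simp
    qed
    then have "(LINT x:test_space \<kappa> h s|lborel. f x * F (s - x)) =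
        (LINT x:cbox (-b) b|lborel. g x * F (s - x))"
      unfolding set_lebesgue_integral_def by presburger
    also have "\<dots> = integral (cbox (-b) b) (\<lambda>x. g x * F (s - x))"
      by (intro set_borel_integral_eq_integral(2) set_integrable_compact_continuous
          compact_cbox continuous_intros continuous_on_subset[OF g]
          continuous_on_compose2[OF F(1)]) auto
    finally show ?thesis .
  qed
  \<comment> \<open>Leibniz' rule wants the derivative as a continuous family of bounded linear
    maps; in finite dimension, continuity of each \<open>Dw x v\<close> in \<open>x\<close> gives
    continuity in operator norm.\<close>
  define W where "W x = Blinfun (Dw x)" for x
  have W: "blinfun_apply (W x) = Dw x" for x
    unfolding W_def
    by (rule bounded_linear_Blinfun_apply[OF has_derivative_bounded_linear[OF kernel_has_derivative]])
  have Wcont: "continuous_on UNIV W"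
    by (rule continuous_on_blinfun_componentwise) (simp add: W Dw_continuous)
  define fx where "fx s x = g x *\<^sub>R W (s - x)" for s x
  have fxcont: "continuous_on (UNIV \<times> cbox (-b) b) (\<lambda>(s, x). fx s x)"
    unfolding fx_def case_prod_unfold
    by (intro continuous_intros continuous_on_compose2[OF Wcont] continuous_on_compose2[OF g]) auto
  have "((\<lambda>s. integral (cbox (-b) b) (\<lambda>x. g x * w (s - x))) has_derivative
      integral (cbox (-b) b) (fx r)) (at r within UNIV)"
  proof (rule leibniz_rule[where fx = fx])
    fix s x
    have "((\<lambda>s. g x * w (s - x)) has_derivative (\<lambda>v. g x * Dw (s - x) v)) (at s)"
      by (rule has_derivative_mult_right[OF shifted_kernel_has_derivative])
    moreover have "blinfun_apply (fx s x) = (\<lambda>v. g x * Dw (s - x) v)"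
      by (simp add: fun_eq_iff fx_def W blinfun.bilinear_simps)
    ultimately show "((\<lambda>s. g x * w (s - x)) has_derivative blinfun_apply (fx s x)) (at s within UNIV)"
      by simp
  next
    show "(\<lambda>x. g x * w (s - x)) integrable_on cbox (-b) b" for s
      by (intro integrable_continuous continuous_intros continuous_on_subset[OF g]
          continuous_on_compose2[OF kernel_continuous]) auto
  qed (use fxcont in auto)
  \<comment> \<open>Evaluation at \<open>v\<close> passes through the integral of linear maps;
    \<open>move\<close> with \<open>F\<close> the derivative along \<open>v\<close> then returns to
    the test space.\<close>
  moreover have "blinfun_apply (integral (cbox (-b) b) (fx r)) =
      (\<lambda>v. LINT x:test_space \<kappa> h r|lborel. f x * Dw (r - x) v)"
  proof
    fix v
    have "continuous_on (cbox (-b) b) (fx r)"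
      unfolding fx_def
      by (intro continuous_intros continuous_on_compose2[OF Wcont] continuous_on_subset[OF g]) auto
    then have "blinfun_apply (integral (cbox (-b) b) (fx r)) v =
        integral (cbox (-b) b) (\<lambda>x. fx r x v)"
      by (intro blinfun_apply_integral integrable_continuous)
    also have "\<dots> = integral (cbox (-b) b) (\<lambda>x. g x * Dw (r - x) v)"
      by (simp add: fx_def W blinfun.bilinear_simps)
    also have "\<dots> = (LINT x:test_space \<kappa> h r|lborel. f x * Dw (r - x) v)"
      using move[of r "\<lambda>x. Dw x v"] Dw_continuous Dw_zero_outside e by simp
    finally show "blinfun_apply (integral (cbox (-b) b) (fx r)) v =
        (LINT x:test_space \<kappa> h r|lborel. f x * Dw (r - x) v)" .
  qed
  ultimately have "((\<lambda>s. integral (cbox (-b) b) (\<lambda>x. g x * w (s - x))) has_derivative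
      (\<lambda>v. LINT x:test_space \<kappa> h r|lborel. f x * Dw (r - x) v)) (at r)"
    by simp
  then show ?thesis
    by (rule has_derivative_transform_within_open[of _ _ _ _ "ball r e"])
      (use e move kernel_continuous kernel_zero_outside in auto)
qed

section \<open>Positivity of the filtered density\<close>

lemma filtered_density_pos:
  assumes \<rho>: "continuous_on \<Omega> \<rho>" "\<And>x. x \<in> \<Omega> \<Longrightarrow> \<rho> x > 0" and r: "r \<in> filter_domain \<kappa> h \<Omega>"
  shows "filtered_density \<kappa> h w \<rho> r > 0"
proof -
  let ?T = "test_space \<kappa> h r"
  have T: "?T \<subseteq> \<Omega>" "compact ?T" "?T \<noteq> {}"
    using r pos by (auto simp: filter_domain_def test_space_eq_cball)
  \<comment> \<open>The minimum of \<open>\<rho>\<close> over the compact test space is positive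
    and, since the kernel has mass one, bounds the filtered density from below.\<close>
  obtain y where y: "y \<in> ?T" "\<And>x. x \<in> ?T \<Longrightarrow> \<rho> y \<le> \<rho> x"
    using continuous_attains_inf[OF T(2,3) continuous_on_subset[OF \<rho>(1) T(1)]] by metis
  have wc: "continuous_on ?T (\<lambda>x. w (r - x))"
    by (intro continuous_intros continuous_on_compose2[OF kernel_continuous]) auto
  have "w \<in> borel_measurable borel"
    by (rule borel_measurable_continuous_onI[OF kernel_continuous])
  then have "1 = (LINT x|lborel. w (r - x))"
    using kernel by (simp add: lborel_integral_reflect filter_kernel_def)
  also have "\<dots> = (LINT x:?T|lborel. w (r - x))"
    unfolding set_lebesgue_integral_def
    by (intro Bochner_Integration.integral_cong)
      (auto simp: indicator_def test_space_def kernel_zero_outside)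
  finally have "\<rho> y = (LINT x:?T|lborel. \<rho> y * w (r - x))" by simp
  also have "\<dots> \<le> (LINT x:?T|lborel. \<rho> x * w (r - x))"
  proof (rule set_integral_mono)
    show "set_integrable lborel ?T (\<lambda>x. \<rho> y * w (r - x))"
      by (intro set_integrable_compact_continuous T continuous_intros wc)
    show "set_integrable lborel ?T (\<lambda>x. \<rho> x * w (r - x))"
      by (intro set_integrable_compact_continuous T continuous_intros wc
          continuous_on_subset[OF \<rho>(1)])
    show "\<rho> y * w (r - x) \<le> \<rho> x * w (r - x)" if "x \<in> ?T" for x
      using y(2)[OF that] kernel by (intro mult_right_mono) (auto simp: filter_kernel_def)
  qed
  finally show ?thesis using \<rho>(2) y(1) T(1) unfolding filtered_density_def by force
qed

section \<open>Kernel gradient and quadratic integrands\<close>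

lemma partial_deriv_kernel: "partial_deriv j (\<lambda>s. w (s - x)) r = Dw (r - x) (axis j 1)"
  by (rule partial_deriv_eq_derivative[OF shifted_kernel_has_derivative])

lemma continuous_on_reflected:
  "continuous_on UNIV k \<Longrightarrow> continuous_on S (\<lambda>x. k (s - x))" for k :: "real^'n \<Rightarrow> real"
  by (rule continuous_on_compose2) (auto intro!: continuous_intros)

text \<open>Pointwise expansion and linearity. The weight \<open>k\<close> is left general: the
  kernel itself gives the formula for the stress, and a directional derivative of the kernel gives
  the formula for its derivative.\<close>

lemma set_integral_quadratic:
  fixes f p q k :: "real^'n \<Rightarrow> real"
  assumes c: "continuous_on \<Omega> f" "continuous_on \<Omega> p" "continuous_on \<Omega> q" "continuous_on UNIV k"
    and s: "s \<in> filter_domain \<kappa> h \<Omega>"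
  shows "(LINT x:test_space \<kappa> h s|lborel. f x * k (s - x) * ((p x - a) * (q x - b))) =
      (LINT x:test_space \<kappa> h s|lborel. f x * p x * q x * k (s - x))
      - a * (LINT x:test_space \<kappa> h s|lborel. f x * q x * k (s - x))
      - b * (LINT x:test_space \<kappa> h s|lborel. f x * p x * k (s - x))
      + a * b * (LINT x:test_space \<kappa> h s|lborel. f x * k (s - x))"
proof -
  let ?T = "test_space \<kappa> h s"
  note ci = set_integrable_test_space[OF _ s] continuous_intros c(1-3) continuous_on_reflected[OF c(4)]
  have "(LINT x:?T|lborel. f x * k (s - x) * ((p x - a) * (q x - b))) =
      (LINT x:?T|lborel. f x * p x * q x * k (s - x) - a * (f x * q x * k (s - x))
        - b * (f x * p x * k (s - x)) + a * b * (f x * k (s - x)))"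
    by (simp add: algebra_simps)
  also have "\<dots> = (LINT x:?T|lborel. f x * p x * q x * k (s - x))
      - (LINT x:?T|lborel. a * (f x * q x * k (s - x)))
      - (LINT x:?T|lborel. b * (f x * p x * k (s - x)))
      + (LINT x:?T|lborel. a * b * (f x * k (s - x)))"
    by (subst set_integral_add(2) set_integral_diff(2); (intro ci)?)+ simp
  finally show ?thesis by simp
qed

section \<open>Velocity and stress in terms of filtered moments\<close>

context
  fixes \<rho> :: "real^'n \<Rightarrow> real" and u :: "real^'n \<Rightarrow> real^'n"
  assumes \<rho>_cont: "continuous_on \<Omega> \<rho>" and u_cont: "continuous_on \<Omega> u"
begin

lemma u_nth_cont: "continuous_on \<Omega> (\<lambda>x. u x $ i)"
  by (intro continuous_intros u_cont)

lemma filtered_velocity_nth: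
  assumes "s \<in> filter_domain \<kappa> h \<Omega>"
  shows "filtered_velocity \<kappa> h w \<rho> u s $ i =
    (LINT x:test_space \<kappa> h s|lborel. \<rho> x * u x $ i * w (s - x)) / filtered_density \<kappa> h w \<rho> s"
proof -
  have "set_integrable lborel (test_space \<kappa> h s) (\<lambda>x. (\<rho> x * w (s - x)) *\<^sub>R u x)"
    by (intro set_integrable_test_space assms continuous_intros \<rho>_cont u_cont
        continuous_on_reflected kernel_continuous)
  from integral_bounded_linear[OF bounded_linear_vec_nth[of i] this[unfolded set_integrable_def]]
  show ?thesis
    by (simp add: filtered_velocity_def set_lebesgue_integral_def divide_inverse mult_ac)
qed

lemma continuous_on_tensor_prod:
  assumes "continuous_on S a" "continuous_on S c"
  shows "continuous_on S (\<lambda>x. tensor_prod (a x) (c x))"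
  unfolding tensor_prod_def by (intro continuous_intros assms)

text \<open>The variance identity. With velocity \<open>p/m\<close>, the two cross terms and the
  last term of the expansion combine to a single \<open>- p\<^sub>i p\<^sub>j / m\<close>. What
  remains depends on \<open>s\<close> only through filtered integrals whose densities do not involve
  \<open>s\<close>.\<close>

lemma subgrid_stress_nth:
  assumes s: "s \<in> filter_domain \<kappa> h \<Omega>"
  shows "subgrid_stress \<kappa> h w \<rho> u s $ i $ j =
      (LINT x:test_space \<kappa> h s|lborel. \<rho> x * u x $ i * u x $ j * w (s - x))
      - (LINT x:test_space \<kappa> h s|lborel. \<rho> x * u x $ i * w (s - x))
        * (LINT x:test_space \<kappa> h s|lborel. \<rho> x * u x $ j * w (s - x))
        / (LINT x:test_space \<kappa> h s|lborel. \<rho> x * w (s - x))"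
proof -
  let ?U = "filtered_velocity \<kappa> h w \<rho> u s"
  have "set_integrable lborel (test_space \<kappa> h s)
      (\<lambda>x. (\<rho> x * w (s - x)) *\<^sub>R tensor_prod (u x - ?U) (u x - ?U))"
    by (intro set_integrable_test_space s continuous_intros \<rho>_cont u_cont continuous_on_tensor_prod
        continuous_on_reflected kernel_continuous)
  moreover have "bounded_linear (\<lambda>M::real^'n^'n. M $ i $ j)"
    using bounded_linear_compose[OF bounded_linear_vec_nth[of j] bounded_linear_vec_nth[of i]] .
  ultimately have stress: "subgrid_stress \<kappa> h w \<rho> u s $ i $ j =
      (LINT x:test_space \<kappa> h s|lborel. \<rho> x * w (s - x) * ((u x $ i - ?U $ i) * (u x $ j - ?U $ j)))"
    unfolding subgrid_stress_def set_lebesgue_integral_def set_integrable_def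
    by (subst integral_bounded_linear[symmetric, where T = "\<lambda>M. M $ i $ j"])
      (simp_all add: tensor_prod_def mult.assoc)
  show ?thesis
    unfolding stress set_integral_quadratic[OF \<rho>_cont u_nth_cont u_nth_cont kernel_continuous s]
      filtered_velocity_nth[OF s]
    \<comment> \<open>if the density vanishes, division by zero makes both the velocity and the quotient \<open>0\<close>\<close>
    by (cases "filtered_density \<kappa> h w \<rho> s = 0") (simp_all add: filtered_density_def field_simps)
qed

text \<open>The product and quotient rules, with \<open>p/m\<close> replaced by \<open>U\<close>,
  give exactly the quadratic expansion with the kernel differentiated and \<open>U\<close> frozen at
  \<open>r\<close>. No derivative of the velocity survives, reflecting that the weighted deviations
  \<open>u - U\<close> have integral zero.\<close>

theorem subgrid_stress_nth_has_derivative: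
  assumes r: "r \<in> filter_domain \<kappa> h \<Omega>" and m: "filtered_density \<kappa> h w \<rho> r \<noteq> 0"
  defines "U \<equiv> filtered_velocity \<kappa> h w \<rho> u r"
  shows "((\<lambda>s. subgrid_stress \<kappa> h w \<rho> u s $ i $ j) has_derivative
    (\<lambda>v. LINT x:test_space \<kappa> h r|lborel.
      \<rho> x * Dw (r - x) v * ((u x $ i - U $ i) * (u x $ j - U $ j)))) (at r)"
proof -
  define I where "I f s = (LINT x:test_space \<kappa> h s|lborel. f x * w (s - x))" for f s
  define D where "D f v = (LINT x:test_space \<kappa> h r|lborel. f x * Dw (r - x) v)" for f v
  let ?m = "I \<rho>" and ?p = "\<lambda>i. I (\<lambda>x. \<rho> x * u x $ i)"
    and ?A = "I (\<lambda>x. \<rho> x * u x $ i * u x $ j)"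
  have I: "(I f has_derivative D f) (at r)" if "continuous_on \<Omega> f" for f
    using filtered_integral_has_derivative[OF that r] unfolding I_def D_def .
  have m0: "?m r \<noteq> 0" using m by (simp add: I_def filtered_density_def)
  have U: "U $ l = ?p l r / ?m r" for l
    by (simp add: U_def filtered_velocity_nth[OF r] I_def filtered_density_def)
  have dm: "(?m has_derivative D \<rho>) (at r)" by (rule I[OF \<rho>_cont])
  have dp: "(?p l has_derivative D (\<lambda>x. \<rho> x * u x $ l)) (at r)" for l
    by (intro I continuous_intros \<rho>_cont u_cont)
  have dA: "(?A has_derivative D (\<lambda>x. \<rho> x * u x $ i * u x $ j)) (at r)"
    by (intro I continuous_intros \<rho>_cont u_cont)
  have "((\<lambda>s. ?A s - ?p i s * ?p j s / ?m s) has_derivative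
    (\<lambda>v. D (\<lambda>x. \<rho> x * u x $ i * u x $ j) v - U $ i * D (\<lambda>x. \<rho> x * u x $ j) v
       - U $ j * D (\<lambda>x. \<rho> x * u x $ i) v + U $ i * U $ j * D \<rho> v)) (at r)"
    by (rule has_derivative_eq_rhs[OF has_derivative_diff[OF dA
          has_derivative_divide'[OF has_derivative_mult[OF dp dp] dm m0]]])
      (use m0 in \<open>simp add: U fun_eq_iff field_simps\<close>)
  \<comment> \<open>The quadratic expansion read backwards, with the derivative along
    \<open>v\<close> as weight.\<close>
  also have "(\<lambda>v. D (\<lambda>x. \<rho> x * u x $ i * u x $ j) v - U $ i * D (\<lambda>x. \<rho> x * u x $ j) v
       - U $ j * D (\<lambda>x. \<rho> x * u x $ i) v + U $ i * U $ j * D \<rho> v) =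
    (\<lambda>v. LINT x:test_space \<kappa> h r|lborel.
      \<rho> x * Dw (r - x) v * ((u x $ i - U $ i) * (u x $ j - U $ j)))"
    unfolding D_def set_integral_quadratic[OF \<rho>_cont u_nth_cont u_nth_cont Dw_continuous r] ..
  finally have *: "((\<lambda>s. ?A s - ?p i s * ?p j s / ?m s) has_derivative
    (\<lambda>v. LINT x:test_space \<kappa> h r|lborel.
      \<rho> x * Dw (r - x) v * ((u x $ i - U $ i) * (u x $ j - U $ j)))) (at r)" .
  obtain S where S: "open S" "r \<in> S" "\<And>s. s \<in> S \<Longrightarrow> s \<in> filter_domain \<kappa> h \<Omega>"
    using eventually_filter_domain[OF r] unfolding eventually_nhds by blast
  show ?thesis
    by (rule has_derivative_transform_within_open[OF * S(1,2)])
      (simp add: subgrid_stress_nth[OF S(3)] I_def)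
qed

section \<open>Divergence of the stress\<close>

theorem tensor_div_subgrid_stress:
  assumes r: "r \<in> filter_domain \<kappa> h \<Omega>" and m: "filtered_density \<kappa> h w \<rho> r \<noteq> 0"
  defines "U \<equiv> filtered_velocity \<kappa> h w \<rho> u r"
  shows "tensor_div (subgrid_stress \<kappa> h w \<rho> u) r =
    (LINT x:test_space \<kappa> h r|lborel.
       \<rho> x *\<^sub>R (tensor_prod (u x - U) (u x - U) *v grad (\<lambda>s. w (s - x)) r))"
proof (rule vec_eq_iff[THEN iffD2, rule_format])
  fix i
  let ?T = "test_space \<kappa> h r"
  let ?f = "\<lambda>j x. \<rho> x * Dw (r - x) (axis j 1) * ((u x $ i - U $ i) * (u x $ j - U $ j))"
  let ?F = "\<lambda>x. \<rho> x *\<^sub>R (tensor_prod (u x - U) (u x - U) *v grad (\<lambda>s. w (s - x)) r)"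
  \<comment> \<open>The contraction is \<open>u - U\<close> times its inner product with the kernel
    gradient; written in coordinates, its \<open>i\<close>-th entry is the sum over \<open>j\<close>
    of the integrands obtained by differentiating entry \<open>i\<close>, \<open>j\<close> of the
    stress along \<open>axis j 1\<close>.\<close>
  have F_nth: "?F x $ i = (\<Sum>j\<in>UNIV. ?f j x)" for x
    by (simp add: tensor_prod_contract inner_vec_def grad_def partial_deriv_kernel
        sum_distrib_left sum_distrib_right mult_ac)
  have f_cont: "continuous_on \<Omega> (?f j)" for j
    by (intro continuous_intros \<rho>_cont u_cont
        continuous_on_reflected[of "\<lambda>x. Dw x (axis j 1)"] Dw_continuous)
  \<comment> \<open>Gives integrability of the vector-valued integrand, so that taking a component
    commutes with its integral.\<close>
  have F_cont: "continuous_on \<Omega> ?F"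
    unfolding tensor_prod_contract inner_vec_def grad_def partial_deriv_kernel
    by (intro continuous_intros \<rho>_cont u_cont
        continuous_on_reflected[of "\<lambda>x. Dw x (axis _ 1)"] Dw_continuous)
  have "tensor_div (subgrid_stress \<kappa> h w \<rho> u) r $ i = (\<Sum>j\<in>UNIV. LINT x:?T|lborel. ?f j x)"
    unfolding tensor_div_def vec_lambda_beta U_def
    by (intro sum.cong refl partial_deriv_eq_derivative[OF subgrid_stress_nth_has_derivative[OF r m]])
  also have "\<dots> = (LINT x:?T|lborel. ?F x $ i)"
    unfolding set_lebesgue_integral_def F_nth scaleR_sum_right
    by (rule Bochner_Integration.integral_sum[symmetric])
      (rule set_integrable_test_space[OF f_cont r, unfolded set_integrable_def])
  also have "\<dots> = (LINT x:?T|lborel. ?F x) $ i"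
    using integral_bounded_linear[OF bounded_linear_vec_nth[of i]
        set_integrable_test_space[OF F_cont r, unfolded set_integrable_def]]
    by (simp add: set_lebesgue_integral_def mult.assoc)
  finally show "tensor_div (subgrid_stress \<kappa> h w \<rho> u) r $ i = (LINT x:?T|lborel. ?F x) $ i" .
qed

text \<open>Ensures that the divergence is built from genuine derivatives, since
  \<open>deriv\<close> has an unspecified value where no derivative exists.\<close>

lemma subgrid_stress_differentiable:
  assumes "r \<in> filter_domain \<kappa> h \<Omega>" "filtered_density \<kappa> h w \<rho> r \<noteq> 0"
  shows "subgrid_stress \<kappa> h w \<rho> u differentiable (at r)"
proof -
  have "(\<lambda>s. subgrid_stress \<kappa> h w \<rho> u s $ i $ j) differentiable (at r)" for i j
    using subgrid_stress_nth_has_derivative[OF assms] unfolding differentiable_def by blast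
  then show ?thesis
    by (subst differentiable_componentwise_within)
      (auto simp: Basis_vec_def inner_axis)
qed

end

end

theorem mainTheorem4:
  fixes \<Omega> :: "(real^'n::finite) set"
    and \<kappa> h :: real
    and w :: "real^'n \<Rightarrow> real"
    and \<rho> :: "real^'n \<Rightarrow> real"
    and u :: "real^'n \<Rightarrow> real^'n"
  assumes "open \<Omega>"
    and "h > 0" and "\<kappa> > 0"
    and "filter_kernel \<kappa> h w"
    and "smooth_on \<Omega> \<rho>" and "\<forall>x\<in>\<Omega>. \<rho> x > 0"
    and "smooth_on \<Omega> u"
  shows "\<forall>r \<in> filter_domain \<kappa> h \<Omega>.
    subgrid_stress \<kappa> h w \<rho> u differentiable (at r) \<and>
    tensor_div (subgrid_stress \<kappa> h w \<rho> u) r =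
      (LINT r':test_space \<kappa> h r|lborel.
         \<rho> r' *\<^sub>R
           (tensor_prod (u r' - filtered_velocity \<kappa> h w \<rho> u r)
                        (u r' - filtered_velocity \<kappa> h w \<rho> u r)
              *v grad (\<lambda>s. w (s - r')) r))"
proof
  fix r assume r: "r \<in> filter_domain \<kappa> h \<Omega>"
  have pos: "\<kappa> * h > 0" using assms by simp
  have \<rho>: "continuous_on \<Omega> \<rho>" and u: "continuous_on \<Omega> u"
    using assms by (auto intro: smooth_on_continuous_on)
  \<comment> \<open>Positivity of \<open>\<rho>\<close> enters here and makes the filtered velocity
    a true quotient.\<close>
  have m: "filtered_density \<kappa> h w \<rho> r \<noteq> 0"
    using filtered_density_pos[OF assms(4) pos assms(1) \<rho> _ r] assms(6) by force
  show "subgrid_stress \<kappa> h w \<rho> u differentiable (at r) \<and>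
    tensor_div (subgrid_stress \<kappa> h w \<rho> u) r =
      (LINT r':test_space \<kappa> h r|lborel.
         \<rho> r' *\<^sub>R
           (tensor_prod (u r' - filtered_velocity \<kappa> h w \<rho> u r)
                        (u r' - filtered_velocity \<kappa> h w \<rho> u r)
              *v grad (\<lambda>s. w (s - r')) r))"
    using subgrid_stress_differentiable[OF assms(4) pos assms(1) \<rho> u r m]
      tensor_div_subgrid_stress[OF assms(4) pos assms(1) \<rho> u r m] by blast
qed

end
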